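(* There are constants $\beta,\kappa_2>0$ such that, if $R$ and $n$ are integers with $d(n)<\beta R^3$, then $$P\big((R,0)\in A(n)\big)\ \le\ \exp\big(-\kappa_2R^2\big).$$
   Context: The comb lattice $\mathcal{C}$ is the graph with vertex set $\mathbb{Z}^2$ in which $(x,y)$ and $(x',y')$ are neighbors if either $x=x'$ and $|y-y'|=1$, or $y=y'=0$ and $|x-x'|=1$. The simple random walk on $\mathcal{C}$ jumps at each step to a uniformly chosen neighbor. Internal DLA on $\mathcal{C}$ is the Markov chain on finite subsets of $\mathbb{Z}^2$ started from the empty set and growing as follows: given the current cluster $A$, launch an (independent) simple random walk on $\mathcal{C}$ from the origin (an "explorer"), stop it at the first site $z\notin A$ that it visits (possibly at time $0$), and let the new cluster be $A\cup\{z\}$. For real $\rho$, $\mathcal{D}(\rho)=\{(x,y)\in\mathbb{Z}^2:\ |x|<\rho,\ |y|<\frac13(\rho-|x|)^2\}$. For an integer $n$, $d(n)=|\mathcal{D}(n)|$, and $A(n)$ is the internal DLA cluster obtained after sending $d(n)$ explorers from the origin. *)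

theory Defs
  imports "HOL-Probability.Probability"
begin

type_synonym site = "int \<times> int"

fun comb_adj :: "site \<Rightarrow> site \<Rightarrow> bool" where
  "comb_adj (x, y) (x', y') \<longleftrightarrow>
     (x = x' \<and> \<bar>y - y'\<bar> = 1) \<or> (y = 0 \<and> y' = 0 \<and> \<bar>x - x'\<bar> = 1)"

definition comb_nbrs :: "site \<Rightarrow> site set" where
  "comb_nbrs z = {w. comb_adj z w}"

lemma comb_nbrs_eq:
  "comb_nbrs (x, y) =
     {(x, y + 1), (x, y - 1)} \<union> (if y = 0 then {(x + 1, 0), (x - 1, 0)} else {})"
  by (auto simp: comb_nbrs_def)

lemma finite_comb_nbrs [simp]: "finite (comb_nbrs z)"
  by (cases z) (simp add: comb_nbrs_eq)

lemma comb_nbrs_nonempty [simp]: "comb_nbrs z \<noteq> {}"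
  by (cases z) (simp add: comb_nbrs_eq)

text \<open>
  The simple random walk on the comb, currently at \<open>z\<close>, stopped at the first site outside \<open>A\<close>
  that it visits (the current site included); the result is the law of the stopping site. The
  recursion is the least fixed point among subprobability distributions, so any missing mass would
  be the probability of never leaving \<open>A\<close>. It is zero for finite \<open>A\<close>, see
  \<open>lossless_explorer\<close> below.
\<close>

partial_function (spmf) explorer :: "site set \<Rightarrow> site \<Rightarrow> site spmf" where
  "explorer A z =
     (if z \<notin> A then return_spmf z else bind_spmf (spmf_of_set (comb_nbrs z)) (explorer A))"

primrec idla :: "nat \<Rightarrow> site set spmf" where
  "idla 0 = return_spmf {}"
| "idla (Suc k) = bind_spmf (idla k) (\<lambda>A. map_spmf (\<lambda>z. insert z A) (explorer A (0, 0)))"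

definition D_comb :: "real \<Rightarrow> site set" where
  "D_comb \<rho> = {(x, y). real_of_int \<bar>x\<bar> < \<rho> \<and>
     real_of_int \<bar>y\<bar> < 1 / 3 * (\<rho> - real_of_int \<bar>x\<bar>)\<^sup>2}"

definition d_comb :: "int \<Rightarrow> nat" where
  "d_comb n = card (D_comb (real_of_int n))"

definition idla_cluster :: "int \<Rightarrow> site set spmf" where
  "idla_cluster n = idla (d_comb n)"


subsection \<open>Well-definedness\<close>

lemma lossless_explorer:
  assumes fin: "finite A"
  shows "lossless_spmf (explorer A z)"
proof -
  define l where "l z = pmf (explorer A z) None" for z
  have l_out: "l z = 0" if "z \<notin> A" for z
    using that by (simp add: l_def explorer.simps)
  have l_in: "l z = (\<Sum>w\<in>comb_nbrs z. l w) / card (comb_nbrs z)" if "z \<in> A" for z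
  proof -
    have "pmf (spmf_of_set (comb_nbrs z)) None = 0"
      using lossless_spmf_of_set[of "comb_nbrs z"] by (simp add: lossless_iff_pmf_None)
    then show ?thesis
      unfolding l_def using that
      by (subst explorer.simps) (simp add: pmf_bind_spmf_None integral_spmf_of_set)
  qed
  have "l z = 0" for z
  proof (rule ccontr)
    assume nz: "l z \<noteq> 0"
    with l_out have zA: "z \<in> A" by blast
    define m where "m = Max (l ` A)"
    have le_m: "l w \<le> m" if "w \<in> A" for w
      using fin that by (simp add: m_def)
    have "l z > 0" using nz by (simp add: l_def pmf_nonneg less_le)
    with le_m[OF zA] have m_pos: "m > 0" by simp
    have le_m': "l w \<le> m" for w
      using le_m l_out m_pos by (cases "w \<in> A") auto
    define B where "B = {w \<in> A. l w = m}"
    have finB: "finite B" using fin by (simp add: B_def)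
    have "m \<in> l ` A" unfolding m_def using fin zA by (intro Max_in) auto
    then have "B \<noteq> {}" by (auto simp: B_def)
    then obtain u where u: "u \<in> B" "snd u = Max (snd ` B)"
      using Max_in[of "snd ` B"] finB by fastforce
    obtain x y where xy: "u = (x, y)" by (cases u)
    have up: "(x, y + 1) \<in> comb_nbrs u" by (simp add: xy comb_nbrs_eq)
    have card_pos: "card (comb_nbrs u) > 0" by (simp add: card_gt_0_iff)
    have "(\<Sum>w\<in>comb_nbrs u. l w) = (\<Sum>w\<in>comb_nbrs u. m)"
      using l_in[of u] u(1) card_pos by (simp add: B_def field_simps)
    then have "(\<Sum>w\<in>comb_nbrs u. m - l w) = 0" by (simp add: sum_subtractf)
    then have "m - l (x, y + 1) = 0"
      using le_m' up by (subst (asm) sum_nonneg_eq_0_iff) auto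
    then have "(x, y + 1) \<in> B" using l_out m_pos by (force simp: B_def)
    then have "y + 1 \<le> Max (snd ` B)" using finB by (force intro: Max_ge)
    with u(2) xy show False by simp
  qed
  then show ?thesis by (simp add: lossless_iff_pmf_None l_def)
qed

lemma finite_idla: "A \<in> set_spmf (idla k) \<Longrightarrow> finite A"
  by (induction k arbitrary: A) (auto simp: set_bind_spmf)

lemma lossless_idla: "lossless_spmf (idla k)"
  by (induction k) (auto simp: lossless_explorer finite_idla)

lemma finite_D_comb: "finite (D_comb \<rho>)"
proof (rule finite_subset)
  let ?b = "\<lceil>\<rho>\<rceil>" and ?c = "\<lceil>1 / 3 * \<rho>\<^sup>2\<rceil>"
  show "D_comb \<rho> \<subseteq> {- ?b..?b} \<times> {- ?c..?c}"
  proof clarify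
    fix x y assume "(x, y) \<in> D_comb \<rho>"
    then have x: "real_of_int \<bar>x\<bar> < \<rho>"
      and y: "real_of_int \<bar>y\<bar> < 1 / 3 * (\<rho> - real_of_int \<bar>x\<bar>)\<^sup>2"
      by (simp_all add: D_comb_def)
    have "(\<rho> - real_of_int \<bar>x\<bar>)\<^sup>2 \<le> \<rho>\<^sup>2"
      using x by (intro power_mono) simp_all
    with y have "real_of_int \<bar>y\<bar> < 1 / 3 * \<rho>\<^sup>2" by linarith
    with x have "\<bar>x\<bar> \<le> ?b" "\<bar>y\<bar> \<le> ?c" by linarith+
    then show "x \<in> {- ?b..?b} \<and> y \<in> {- ?c..?c}" by auto
  qed
qed simp

end

theory Submission
  imports Defs
begin

text \<open>
  Let \<open>N < \<beta> R\<^sup>3\<close> explorers be sent. If the tip \<open>(R, 0)\<close> is occupied, then so is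
  the whole axis from \<open>0\<close> to \<open>R\<close>, and the cluster has a profile of column counts
  \<open>h(0), \<dots>, h(R) \<ge> 1\<close> of total mass at most \<open>N\<close>. There are only
  \<open>exp (O(R ln R))\<close> profiles, so it suffices to bound the probability of each single profile by
  \<open>exp (- c R\<^sup>2)\<close>. The gain is that a test function may then be adapted to \<open>h\<close>.

  For fixed \<open>h\<close> every cluster along the growth has at most \<open>h(x)\<close> sites in column
  \<open>x\<close>, so an explorer at \<open>(x, 0)\<close> settles in that column at a rate of at least order
  \<open>1 / h(x)\<close>. Let \<open>F\<close> be positive and nondecreasing on the axis, with
  \<open>F = 1\<close> up to some starting column \<open>a\<close>, \<open>F'' = F / h\<close> between \<open>a\<close> and
  \<open>R\<close>, and \<open>F\<close> linear beyond \<open>R\<close>. Give the sites of column \<open>x\<close> the weight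
  \<open>F(x) / 2\<close> if \<open>a \<le> x \<le> R\<close>, and \<open>F(x)\<close> otherwise. Linear interpolation along the
  teeth extends \<open>F\<close> to a function that is superharmonic on the cluster and dominates the weights
  (\<open>comb_extend_superharmonic_axis\<close>), so the mean weight of the next site is at most
  \<open>F(0) = 1\<close>. Therefore the product of the weights over the cluster is a supermartingale
  (\<open>idla_weight_le\<close>), and the profile \<open>h\<close> has probability at most \<open>exp (- S)\<close> with
  \<open>S\<close> the sum of \<open>h(x) (ln F(x) - ln 2)\<close> over \<open>a \<le> x \<le> R\<close>.

  It remains to choose \<open>a\<close> such that \<open>S \<ge> c R\<^sup>2\<close> (\<open>barrier_gain\<close>). Cut the axis
  into blocks whose mass is a small multiple of the cube of their length \<open>l\<close>. Over each block
  \<open>F\<close> grows by a factor \<open>16\<close> (\<open>growth_light_block\<close>), so \<open>ln F\<close> is at least of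
  order \<open>j\<close> on the \<open>j\<close>-th block, and \<open>S\<close> is at least of the order of the sum of
  \<open>j l\<^sub>j\<^sup>3\<close>. The lengths add up to order \<open>R\<close> and there are at most \<open>R\<close> blocks, so
  by Hoelder's inequality this sum is at least of order \<open>R\<^sup>2\<close> (\<open>tail_weight_ge\<close>). The
  starting column is chosen such that the first block, on which \<open>F / 2\<close> may be smaller than
  one, is outweighed by the columns behind it (\<open>barrier_start\<close>).
\<close>

section \<open>Explorers and superharmonic functions\<close>

text \<open>
  Along a chain the densities increase, so monotone convergence exchanges integral and supremum.
  This makes integral bounds admissible for fixed-point induction.
\<close>

lemma nn_integral_lub_spmf_le:
  assumes chain: "Complete_Partial_Order.chain (ord_spmf (=)) Y" and Y: "Y \<noteq> {}"
    and bound: "\<And>p. p \<in> Y \<Longrightarrow> (\<integral>\<^sup>+x. f x \<partial>measure_spmf p) \<le> c"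
  shows "(\<integral>\<^sup>+x. f x \<partial>measure_spmf (lub_spmf Y)) \<le> c"
proof -
  let ?M = "count_space (set_spmf (lub_spmf Y))"
  have "(\<integral>\<^sup>+x. f x \<partial>measure_spmf (lub_spmf Y)) = (\<integral>\<^sup>+x. (SUP p\<in>Y. ennreal (spmf p x) * f x) \<partial>?M)"
    by (simp add: nn_integral_measure_spmf' ennreal_spmf_lub_spmf[OF chain Y] SUP_mult_right_ennreal Y)
  also have "\<dots> = (SUP p\<in>Y. \<integral>\<^sup>+x. ennreal (spmf p x) * f x \<partial>?M)"
  proof (rule nn_integral_monotone_convergence_SUP_countable)
    show "Complete_Partial_Order.chain (\<le>) ((\<lambda>p x. ennreal (spmf p x) * f x) ` Y)"
      using chain by (rule chain_imageI)
        (auto simp: le_fun_def intro!: mult_right_mono ennreal_leI dest: ord_spmf_eq_leD)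
  qed (use Y in simp_all)
  also have "\<dots> = (SUP p\<in>Y. \<integral>\<^sup>+x. f x \<partial>measure_spmf p)"
    unfolding nn_integral_measure_spmf
    by (intro arg_cong [of _ _ Sup] image_cong)
       (auto simp: nn_integral_count_space_indicator set_lub_spmf[OF chain] spmf_eq_0_set_spmf
         intro!: nn_integral_cong split: split_indicator)
  also have "\<dots> \<le> c" using bound by (rule SUP_least)
  finally show ?thesis .
qed

lemma nn_integral_bind_spmf:
  "(\<integral>\<^sup>+y. f y \<partial>measure_spmf (bind_spmf p q)) = (\<integral>\<^sup>+x. (\<integral>\<^sup>+y. f y \<partial>measure_spmf (q x)) \<partial>measure_spmf p)"
  unfolding measure_spmf_bind
  by (subst nn_integral_bind[where B = "count_space UNIV"]) (simp_all add: measure_spmf_in_space_subprob_algebra comp_def)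

text \<open>
  Optional stopping. As the law of the stopping site is a least fixed point, the bound passes
  through the iterates, one average over neighbours at a time.
\<close>

lemma explorer_superharmonic:
  fixes U f :: "site \<Rightarrow> ennreal"
  assumes superharmonic: "\<And>z. z \<in> A \<Longrightarrow> (\<Sum>w\<in>comb_nbrs z. U w) / card (comb_nbrs z) \<le> U z"
    and outside: "\<And>z. z \<notin> A \<Longrightarrow> f z \<le> U z"
  shows "(\<integral>\<^sup>+z. f z \<partial>measure_spmf (explorer A z)) \<le> U z"
proof -
  have "\<forall>z. (\<integral>\<^sup>+w. f w \<partial>measure_spmf (explorer A z)) \<le> U z"
  proof (rule explorer.fixp_induct)
    show "spmf.admissible (\<lambda>ex. \<forall>z. (\<integral>\<^sup>+w. f w \<partial>measure_spmf (curry ex A z)) \<le> U z)"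
    proof (rule ccpo.admissibleI, rule allI)
      fix Y z
      assume chain: "Complete_Partial_Order.chain spmf.le_fun Y" and ne: "Y \<noteq> {}"
        and *: "\<forall>ex\<in>Y. \<forall>z. (\<integral>\<^sup>+w. f w \<partial>measure_spmf (curry ex A z)) \<le> U z"
      have "{r. \<exists>ex\<in>Y. r = ex (A, z)} = (\<lambda>ex. ex (A, z)) ` Y" by auto
      moreover have "(\<integral>\<^sup>+w. f w \<partial>measure_spmf (lub_spmf ((\<lambda>ex. ex (A, z)) ` Y))) \<le> U z"
      proof (rule nn_integral_lub_spmf_le)
        show "Complete_Partial_Order.chain (ord_spmf (=)) ((\<lambda>ex. ex (A, z)) ` Y)"
          using chain by (rule chain_imageI) (unfold fun_ord_def, blast)
        show "(\<integral>\<^sup>+w. f w \<partial>measure_spmf p) \<le> U z" if "p \<in> (\<lambda>ex. ex (A, z)) ` Y" for p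
          using * that unfolding curry_def by blast
      qed (use ne in simp)
      ultimately show "(\<integral>\<^sup>+w. f w \<partial>measure_spmf (curry (spmf.lub_fun Y) A z)) \<le> U z"
        by (simp add: fun_lub_def)
    qed
  next
    fix ex assume *: "\<forall>z. (\<integral>\<^sup>+w. f w \<partial>measure_spmf (ex A z)) \<le> U z"
    show "\<forall>z. (\<integral>\<^sup>+w. f w \<partial>measure_spmf (if z \<notin> A then return_spmf z
        else bind_spmf (spmf_of_set (comb_nbrs z)) (ex A))) \<le> U z"
    proof
      fix z
      have "(\<Sum>w\<in>comb_nbrs z. \<integral>\<^sup>+v. f v \<partial>measure_spmf (ex A w)) / card (comb_nbrs z) \<le> U z"
        if "z \<in> A"
        using superharmonic[OF that] * by (meson divide_right_mono_ennreal order_trans sum_mono)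
      then show "(\<integral>\<^sup>+w. f w \<partial>measure_spmf (if z \<notin> A then return_spmf z
        else bind_spmf (spmf_of_set (comb_nbrs z)) (ex A))) \<le> U z"
        using outside by (auto simp: nn_integral_bind_spmf nn_integral_spmf_of_set measure_spmf_return_spmf nn_integral_return)
    qed
  qed simp
  then show ?thesis by blast
qed

lemma explorer_superharmonic_real:
  fixes U f :: "site \<Rightarrow> real"
  assumes nonneg: "\<And>z. 0 \<le> U z"
    and superharmonic: "\<And>z. z \<in> A \<Longrightarrow> (\<Sum>w\<in>comb_nbrs z. U w) \<le> card (comb_nbrs z) * U z"
    and outside: "\<And>z. z \<notin> A \<Longrightarrow> f z \<le> U z"
  shows "(\<integral>\<^sup>+z. ennreal (f z) \<partial>measure_spmf (explorer A z)) \<le> ennreal (U z)"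
proof (rule explorer_superharmonic)
  fix z assume "z \<in> A"
  have pos: "0 < card (comb_nbrs z)" by (simp add: card_gt_0_iff)
  have "(\<Sum>w\<in>comb_nbrs z. ennreal (U w)) / card (comb_nbrs z) =
    ennreal ((\<Sum>w\<in>comb_nbrs z. U w) / card (comb_nbrs z))"
    using pos by (simp add: nonneg sum_nonneg ennreal_of_nat_eq_real_of_nat divide_ennreal)
  also have "\<dots> \<le> ennreal (U z)"
    using superharmonic[OF \<open>z \<in> A\<close>] pos by (intro ennreal_leI) (simp add: field_simps)
  finally show "(\<Sum>w\<in>comb_nbrs z. ennreal (U w)) / card (comb_nbrs z) \<le> ennreal (U z)" .
qed (simp add: outside ennreal_leI)

text \<open>
  The indicator of the complement of a region that the walk cannot leave is superharmonic on the
  cluster; started inside the region it vanishes, so the stopping site is outside the region with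
  probability zero.
\<close>

lemma set_spmf_explorer:
  assumes start: "z \<in> S" and step: "\<And>z. z \<in> S \<inter> A \<Longrightarrow> comb_nbrs z \<subseteq> S"
  shows "set_spmf (explorer A z) \<subseteq> S - A"
proof -
  let ?U = "indicat_real (- S)" and ?f = "indicat_real (- (S - A))"
  have "(\<integral>\<^sup>+w. ennreal (?f w) \<partial>measure_spmf (explorer A z)) \<le> ennreal (?U z)"
  proof (rule explorer_superharmonic_real)
    fix z assume "z \<in> A"
    show "(\<Sum>w\<in>comb_nbrs z. ?U w) \<le> card (comb_nbrs z) * ?U z"
    proof (cases "z \<in> S")
      case True
      with step \<open>z \<in> A\<close> have "comb_nbrs z \<subseteq> S" by blast
      then have "(\<Sum>w\<in>comb_nbrs z. ?U w) = 0"
        by (intro sum.neutral) (auto simp: indicator_def)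
      then show ?thesis by simp
    next
      case False
      have "(\<Sum>w\<in>comb_nbrs z. ?U w) \<le> (\<Sum>w\<in>comb_nbrs z. 1)"
        by (intro sum_mono) (simp add: indicator_def)
      with False show ?thesis by simp
    qed
  qed (auto simp: indicator_def)
  with start have "emeasure (measure_spmf (explorer A z)) (- (S - A)) = 0"
    by (simp add: ennreal_indicator)
  then show ?thesis
    using measure_spmf_zero_iff[of "explorer A z" "- (S - A)"]
    by (auto simp: measure_spmf.emeasure_eq_measure)
qed

lemma set_spmf_explorer_notin: "z' \<in> set_spmf (explorer A z) \<Longrightarrow> z' \<notin> A"
  using set_spmf_explorer[of z UNIV A] by auto

lemma card_idla: "A \<in> set_spmf (idla k) \<Longrightarrow> card A \<le> k"
proof (induction k arbitrary: A)
  case (Suc k)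
  then obtain B z where "B \<in> set_spmf (idla k)" "A = insert z B" by (auto simp: set_bind_spmf)
  with Suc.IH[of B] finite_idla[of B k] show ?case by (simp add: card_insert_if)
qed simp

text \<open>
  To enter column \<open>x\<close> the explorer has to step along the axis from the occupied site
  \<open>(x - 1, 0)\<close>.
\<close>

lemma idla_axis_connected:
  assumes "A \<in> set_spmf (idla k)" "(x, 0) \<in> A" "0 < x"
  shows "(x - 1, 0) \<in> A"
  using assms
proof (induction k arbitrary: A x)
  case (Suc k)
  then obtain B z where B: "B \<in> set_spmf (idla k)" "A = insert z B"
    and z: "z \<in> set_spmf (explorer B (0, 0))" by (auto simp: set_bind_spmf)
  define S where "S = {(x, y :: int) |x y. x \<le> 0 \<or> (x - 1, 0) \<in> B}"
  have "set_spmf (explorer B (0, 0)) \<subseteq> S - B"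
  proof (rule set_spmf_explorer)
    fix z assume z: "z \<in> S \<inter> B"
    obtain x y where xy: "z = (x, y)" by (cases z)
    show "comb_nbrs z \<subseteq> S"
      using z Suc.IH[OF B(1), of "x - 1"] by (cases "1 < x") (auto simp: xy comb_nbrs_eq S_def)
  qed (simp add: S_def)
  with z B Suc.IH[OF B(1), of x] Suc.prems show ?case by (auto simp: S_def)
qed simp

section \<open>Extending functions from the axis to the comb\<close>

definition column :: "site set \<Rightarrow> int \<Rightarrow> int set" where
  "column A x = {y. (x, y) \<in> A}"

lemma finite_column: "finite A \<Longrightarrow> finite (column A x)"
  by (rule finite_surj[of A _ snd]) (force simp: column_def)+

text \<open>
  The sign \<open>s\<close> is the direction in which the tooth is climbed, \<open>1\<close> or \<open>- 1\<close>. The axis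
  site is skipped, so that the gap is positive and one can divide by it.
\<close>

definition tooth_gap :: "site set \<Rightarrow> int \<Rightarrow> int \<Rightarrow> nat" where
  "tooth_gap A x s = (LEAST n. 0 < n \<and> (x, s * int n) \<notin> A)"

text \<open>
  All sites below the gap belong to the column, so the gap is at most the number of occupied sites
  of the column. This is how a column count controls the risk that an explorer settles in it.
\<close>

lemma tooth_gap:
  assumes "finite A" "\<bar>s\<bar> = 1"
  shows "0 < tooth_gap A x s" "(x, s * int (tooth_gap A x s)) \<notin> A"
    and "(x, 0) \<in> A \<Longrightarrow> tooth_gap A x s \<le> card (column A x)"
proof -
  let ?P = "\<lambda>n. 0 < n \<and> (x, s * int n) \<notin> A"
  have inj: "inj_on (\<lambda>n. s * int n) N" for N using assms(2) by (auto simp: inj_on_def)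
  have "infinite ((\<lambda>n. s * int n) ` {0<..})"
    using inj by (simp add: finite_image_iff infinite_Ioi)
  then have "\<not> (\<lambda>n. s * int n) ` {0<..} \<subseteq> column A x"
    using finite_subset[OF _ finite_column[OF assms(1)]] by blast
  then have "\<exists>n. ?P n" by (auto simp: column_def)
  then have *: "?P (tooth_gap A x s)" unfolding tooth_gap_def by (rule LeastI_ex)
  then show "0 < tooth_gap A x s" "(x, s * int (tooth_gap A x s)) \<notin> A" by auto
  assume "(x, 0) \<in> A"
  then have "(\<lambda>n. s * int n) ` {..<tooth_gap A x s} \<subseteq> column A x"
    using not_less_Least[of _ ?P, folded tooth_gap_def] by (force simp: column_def)
  from card_mono[OF finite_column[OF assms(1)] this]
  show "tooth_gap A x s \<le> card (column A x)" by (simp add: card_image inj)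
qed

definition tooth_profile :: "nat \<Rightarrow> nat \<Rightarrow> real" where
  "tooth_profile a t = max 0 (1 - real t / real a)"

text \<open>
  The profile is linear except for a convex kink at \<open>a\<close>. In the application the site at
  distance \<open>a\<close> is vacant, and superharmonicity is only required at occupied sites.
\<close>

lemma tooth_profile_superharmonic:
  assumes "0 < t" "t \<noteq> a" "0 < a"
  shows "tooth_profile a (t + 1) + tooth_profile a (t - 1) \<le> 2 * tooth_profile a t"
proof (cases "t < a")
  case True
  then have "tooth_profile a s = 1 - real s / real a" if "s \<le> t + 1" for s
    using that by (simp add: tooth_profile_def)
  from this[of "t + 1"] this[of t] this[of "t - 1"] show ?thesis
    using assms by (simp add: of_nat_diff add_divide_distrib diff_divide_distrib)
next
  case False
  then have "tooth_profile a s = 0" if "t \<le> s + 1" for s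
    using that assms by (simp add: tooth_profile_def)
  then show ?thesis by simp
qed

lemma tooth_profile_0 [simp]: "tooth_profile a 0 = 1"
  by (simp add: tooth_profile_def)

lemma tooth_profile_nonneg: "0 \<le> tooth_profile a t"
  by (simp add: tooth_profile_def)

text \<open>
  On the tooth at \<open>x\<close> the extension interpolates linearly between \<open>F x\<close> on the axis
  and the terminal value \<open>e x\<close> at the first vacant site, and keeps the value \<open>e x\<close>
  beyond it. For \<open>y = 0\<close> the profile is \<open>1\<close>, whatever the gap.
\<close>

definition comb_extend :: "(int \<Rightarrow> real) \<Rightarrow> (int \<Rightarrow> real) \<Rightarrow> site set \<Rightarrow> site \<Rightarrow> real" where
  "comb_extend F e A = (\<lambda>(x, y). e x + (F x - e x) * tooth_profile (tooth_gap A x (sgn y)) (nat \<bar>y\<bar>))"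

lemma comb_extend_axis [simp]: "comb_extend F e A (x, 0) = F x"
  by (simp add: comb_extend_def)

lemma comb_extend_superharmonic_tooth:
  assumes "finite A" "e x \<le> F x" "(x, y) \<in> A" "y \<noteq> 0"
  shows "comb_extend F e A (x, y + 1) + comb_extend F e A (x, y - 1) \<le> 2 * comb_extend F e A (x, y)"
proof -
  define a where "a = tooth_gap A x (sgn y)"
  define t where "t = nat \<bar>y\<bar>"
  have sgn: "\<bar>sgn y\<bar> = 1" using assms(4) by (simp add: sgn_if)
  have y: "y = sgn y * int t" by (simp add: t_def mult_sgn_abs)
  have "t \<noteq> a"
    using tooth_gap(2)[OF assms(1) sgn, of x, folded a_def] assms(3) y by metis
  moreover have "0 < t" "0 < a"
    using tooth_gap(1)[OF assms(1) sgn, of x] assms(4) by (auto simp: t_def a_def)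
  ultimately have t: "0 < t" "t \<noteq> a" "0 < a" by simp_all
  have ext: "comb_extend F e A (x, sgn y * int n) = e x + (F x - e x) * tooth_profile a n" for n
    using assms(4) by (cases "n = 0") (auto simp: comb_extend_def a_def sgn_mult sgn_if abs_mult)
  have "comb_extend F e A (x, y + 1) + comb_extend F e A (x, y - 1) =
      comb_extend F e A (x, sgn y * int (t + 1)) + comb_extend F e A (x, sgn y * int (t - 1))"
    using t(1) assms(4) by (cases "0 < y") (auto simp: t_def sgn_if of_nat_diff nat_add_distrib algebra_simps)
  also have "\<dots> = 2 * e x + (F x - e x) * (tooth_profile a (t + 1) + tooth_profile a (t - 1))"
    unfolding ext by (simp add: algebra_simps)
  also have "\<dots> \<le> 2 * e x + (F x - e x) * (2 * tooth_profile a t)"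
    using tooth_profile_superharmonic[OF t] assms(2) by (intro add_left_mono mult_left_mono) auto
  also have "\<dots> = 2 * comb_extend F e A (x, y)"
    using ext[of t, folded y] by (simp add: algebra_simps)
  finally show ?thesis .
qed

text \<open>
  From \<open>(x, 0)\<close> the two steps into the tooth lower the value by \<open>(F x - e x) / a\<close>
  each, where the gap \<open>a\<close> is at most the column count \<open>h\<close>. This loss pays for a
  convex increment of \<open>F\<close> of size up to \<open>2 (F x - e x) / h\<close>.
\<close>

lemma comb_extend_superharmonic_axis:
  fixes F e :: "int \<Rightarrow> real"
  assumes fin: "finite A" and le: "e x \<le> F x" and mem: "(x, 0) \<in> A"
    and super: "F (x + 1) + F (x - 1) \<le> 2 * F x \<or>
      card (column A x) \<le> h \<and> h * (F (x + 1) + F (x - 1) - 2 * F x) \<le> 2 * (F x - e x)"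
  shows "comb_extend F e A (x, 1) + comb_extend F e A (x, - 1) + F (x + 1) + F (x - 1) \<le> 4 * F x"
proof -
  define a where "a s = tooth_gap A x s" for s
  have ext: "comb_extend F e A (x, s) = F x - (F x - e x) / a s" if s: "\<bar>s\<bar> = 1" for s
  proof -
    have "1 \<le> a s" using tooth_gap(1)[OF fin s, of x] by (simp add: a_def)
    moreover have "sgn s = s" using s by (simp add: sgn_if abs_if split: if_splits)
    moreover have "nat \<bar>s\<bar> = 1" using s by simp
    ultimately show ?thesis
      by (simp only: comb_extend_def tooth_profile_def a_def prod.case) (simp add: field_simps)
  qed
  from super show ?thesis
  proof
    assume "F (x + 1) + F (x - 1) \<le> 2 * F x"
    moreover have "0 \<le> (F x - e x) / a 1" "0 \<le> (F x - e x) / a (- 1)" using le by simp_all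
    ultimately show ?thesis using ext[of 1] ext[of "- 1"] by simp
  next
    assume *: "card (column A x) \<le> h \<and> h * (F (x + 1) + F (x - 1) - 2 * F x) \<le> 2 * (F x - e x)"
    have a: "1 \<le> a s" "a s \<le> h" if "\<bar>s\<bar> = 1" for s
      using tooth_gap[OF fin that, of x] mem * by (auto simp: a_def Suc_le_eq)
    have "1 \<le> h" using a[of 1] by simp
    have "(F x - e x) / h \<le> (F x - e x) / a s" if "\<bar>s\<bar> = 1" for s
      using a[OF that] le by (intro divide_left_mono) auto
    from this[of 1] this[of "- 1"]
    have "2 * ((F x - e x) / h) \<le> (F x - e x) / a 1 + (F x - e x) / a (- 1)" by linarith
    moreover have "F (x + 1) + F (x - 1) - 2 * F x \<le> 2 * ((F x - e x) / h)"
      using * \<open>1 \<le> h\<close> by (simp add: field_simps)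
    ultimately show ?thesis using ext[of 1] ext[of "- 1"] by simp
  qed
qed

section \<open>The weight supermartingale\<close>

definition columns_bounded :: "int set \<Rightarrow> (int \<Rightarrow> nat) \<Rightarrow> site set \<Rightarrow> bool" where
  "columns_bounded J h A \<longleftrightarrow> (\<forall>x\<in>J. card (column A x) \<le> h x)"

text \<open>
  A site of column \<open>x\<close> carries the weight \<open>e x\<close>. As long as the columns in
  \<open>J\<close> have at most \<open>h\<close> occupied sites, \<open>F\<close> extends to a function that is
  superharmonic on the cluster and dominates the weights, whatever the shape of the cluster.
\<close>

locale axis_barrier =
  fixes F e :: "int \<Rightarrow> real" and J :: "int set" and h :: "int \<Rightarrow> nat"
  assumes e_nonneg: "\<And>x. 0 \<le> e x" and e_le: "\<And>x. e x \<le> F x"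
    and free: "\<And>x. x \<notin> J \<Longrightarrow> F (x + 1) + F (x - 1) \<le> 2 * F x"
    and killed: "\<And>x. x \<in> J \<Longrightarrow> h x * (F (x + 1) + F (x - 1) - 2 * F x) \<le> 2 * (F x - e x)"
begin

lemma explorer_weight_le:
  assumes "finite A" "columns_bounded J h A"
  shows "(\<integral>\<^sup>+z. ennreal (e (fst z)) \<partial>measure_spmf (explorer A (0, 0))) \<le> ennreal (F 0)"
proof -
  have "(\<integral>\<^sup>+z. ennreal (e (fst z)) \<partial>measure_spmf (explorer A (0, 0))) \<le> ennreal (comb_extend F e A (0, 0))"
  proof (rule explorer_superharmonic_real)
    fix z show "0 \<le> comb_extend F e A z"
      using e_nonneg e_le tooth_profile_nonneg by (auto simp: comb_extend_def split: prod.split)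
    show "e (fst z) \<le> comb_extend F e A z"
      using e_le tooth_profile_nonneg by (auto simp: comb_extend_def split: prod.split)
  next
    fix z assume z: "z \<in> A"
    obtain x y where xy: "z = (x, y)" by (cases z)
    show "(\<Sum>w\<in>comb_nbrs z. comb_extend F e A w) \<le> card (comb_nbrs z) * comb_extend F e A z"
    proof (cases "y = 0")
      case True
      have "comb_extend F e A (x, 1) + comb_extend F e A (x, - 1) + F (x + 1) + F (x - 1) \<le> 4 * F x"
        using assms z xy True free[of x] killed[of x] e_le[of x]
        by (intro comb_extend_superharmonic_axis[where h = "h x"]) (auto simp: columns_bounded_def)
      then show ?thesis by (simp add: xy True comb_nbrs_eq)
    next
      case False
      then show ?thesis
        using comb_extend_superharmonic_tooth[where F = F and e = e and A = A and x = x and y = y] assms(1) e_le[of x] z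
        by (simp add: xy comb_nbrs_eq)
    qed
  qed
  then show ?thesis by simp
qed

text \<open>
  A new site multiplies the weight of the cluster by a factor whose conditional mean is at most
  \<open>F 0\<close>. The column constraint can only be lost as the cluster grows, so truncating by it
  preserves the supermartingale property.
\<close>

lemma idla_weight_le:
  "(\<integral>\<^sup>+A. (if columns_bounded J h A then ennreal (\<Prod>z\<in>A. e (fst z)) else 0) \<partial>measure_spmf (idla k)) \<le> ennreal (F 0 ^ k)"
proof (induction k)
  case 0
  show ?case by (simp add: measure_spmf_return_spmf nn_integral_return)
next
  case (Suc k)
  let ?W = "\<lambda>A. if columns_bounded J h A then ennreal (\<Prod>z\<in>A. e (fst z)) else 0"
  have F0: "0 \<le> F 0" using e_nonneg e_le order_trans by blast
  have step: "(\<integral>\<^sup>+z. ?W (insert z A) \<partial>measure_spmf (explorer A (0, 0))) \<le> ?W A * ennreal (F 0)"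
    if "A \<in> set_spmf (idla k)" for A
  proof -
    have fin: "finite A" using that by (rule finite_idla)
    have counts_mono: "columns_bounded J h (insert z A) \<Longrightarrow> columns_bounded J h A" for z
    proof -
      have "card (column A x) \<le> card (column (insert z A) x)" for x
        using fin by (intro card_mono finite_column) (auto simp: column_def)
      then show "columns_bounded J h (insert z A) \<Longrightarrow> columns_bounded J h A"
        unfolding columns_bounded_def by (meson order_trans)
    qed
    have "(\<integral>\<^sup>+z. ?W (insert z A) \<partial>measure_spmf (explorer A (0, 0))) \<le>
        (\<integral>\<^sup>+z. ?W A * ennreal (e (fst z)) \<partial>measure_spmf (explorer A (0, 0)))"
      using counts_mono set_spmf_explorer_notin fin
      by (intro nn_integral_mono_AE)
         (auto simp: AE_measure_spmf_iff e_nonneg prod_nonneg ennreal_mult mult.commute)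
    also have "\<dots> = ?W A * (\<integral>\<^sup>+z. ennreal (e (fst z)) \<partial>measure_spmf (explorer A (0, 0)))"
      by (rule nn_integral_cmult) simp
    also have "\<dots> \<le> ?W A * ennreal (F 0)"
      using explorer_weight_le[OF fin] by (auto intro: mult_left_mono)
    finally show ?thesis .
  qed
  have "(\<integral>\<^sup>+A. ?W A \<partial>measure_spmf (idla (Suc k))) =
     (\<integral>\<^sup>+A. (\<integral>\<^sup>+z. ?W (insert z A) \<partial>measure_spmf (explorer A (0, 0))) \<partial>measure_spmf (idla k))"
    by (simp add: nn_integral_bind_spmf comp_def)
  also have "\<dots> \<le> (\<integral>\<^sup>+A. ?W A * ennreal (F 0) \<partial>measure_spmf (idla k))"
    using step by (intro nn_integral_mono_AE) (simp add: AE_measure_spmf_iff)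
  also have "\<dots> = (\<integral>\<^sup>+A. ?W A \<partial>measure_spmf (idla k)) * ennreal (F 0)"
    by (rule nn_integral_multc) simp
  also have "\<dots> \<le> ennreal (F 0 ^ k) * ennreal (F 0)"
    by (rule mult_right_mono[OF Suc.IH]) simp
  also have "\<dots> = ennreal (F 0 ^ Suc k)" using F0 by (simp add: ennreal_mult mult.commute)
  finally show ?case .
qed

end

section \<open>Growth of the barrier\<close>

declare sum.cong [fundef_cong]

text \<open>
  The solution of the discrete equation \<open>F'' = w F\<close> that starts from \<open>1\<close> with
  slope zero, written with the equation summed once.
\<close>

fun growth :: "(nat \<Rightarrow> real) \<Rightarrow> nat \<Rightarrow> real" where
  "growth w 0 = 1"
| "growth w (Suc n) = growth w n + (\<Sum>i\<le>n. w i * growth w i)"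

lemma growth_second_difference:
  "growth w (Suc (Suc n)) + growth w n - 2 * growth w (Suc n) = w (Suc n) * growth w (Suc n)"
  by (simp add: algebra_simps)

declare growth.simps(2) [simp del]

lemma growth_ge_1: "(\<And>i. 0 \<le> w i) \<Longrightarrow> 1 \<le> growth w n"
proof (induction n rule: less_induct)
  case (less n)
  show ?case
  proof (cases n)
    case (Suc m)
    have "0 \<le> (\<Sum>i\<le>m. w i * growth w i)"
      using less.IH less.prems by (intro sum_nonneg mult_nonneg_nonneg) (auto simp: Suc intro: order_trans[OF zero_le_one])
    with less.IH[of m] less.prems show ?thesis by (simp add: Suc growth.simps(2))
  qed simp
qed

lemma growth_mono:
  assumes "\<And>i. 0 \<le> w i" "m \<le> n"
  shows "growth w m \<le> growth w n"
proof -
  have "0 \<le> growth w i" for i using growth_ge_1[where w = w, OF assms(1), of i] by simp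
  then have "growth w n \<le> growth w (Suc n)" for n
    by (simp add: growth.simps(2) sum_nonneg assms(1))
  with assms(2) show ?thesis by (rule lift_Suc_mono_le[rotated])
qed

text \<open>
  On a block that starts at \<open>a\<close> the right-hand side \<open>w F\<close> is at least
  \<open>w F(a)\<close>; summing twice gives the bound.
\<close>

lemma growth_block:
  assumes nonneg: "\<And>i. 0 \<le> w i"
  shows "growth w a * (1 + (\<Sum>i<l. real (l - i) * w (a + i))) \<le> growth w (a + l)"
proof (induction l)
  case (Suc l)
  have pos: "0 \<le> growth w i" for i using growth_ge_1[where w = w, OF nonneg, of i] by simp
  have "growth w a * (\<Sum>i\<le>l. w (a + i)) \<le> (\<Sum>i\<le>l. w (a + i) * growth w (a + i))"
    unfolding sum_distrib_left
  proof (rule sum_mono)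
    fix i show "growth w a * w (a + i) \<le> w (a + i) * growth w (a + i)"
      using mult_right_mono[OF growth_mono[where w = w, OF nonneg, of a "a + i"] nonneg[of "a + i"]]
      by (simp add: mult.commute)
  qed
  also have "\<dots> = (\<Sum>j\<in>(\<lambda>i. a + i) ` {..l}. w j * growth w j)"
    by (subst sum.reindex) (auto simp: inj_on_def)
  also have "\<dots> \<le> (\<Sum>j\<le>a + l. w j * growth w j)"
    by (rule sum_mono2) (auto simp: nonneg pos)
  finally have 1: "growth w a * (\<Sum>i\<le>l. w (a + i)) \<le> (\<Sum>j\<le>a + l. w j * growth w j)" .
  have "(\<Sum>i<Suc l. real (Suc l - i) * w (a + i)) =
      (\<Sum>i<Suc l. real (l - i) * w (a + i) + w (a + i))"
    by (rule sum.cong) (auto simp: Suc_diff_le algebra_simps)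
  also have "\<dots> = (\<Sum>i<l. real (l - i) * w (a + i)) + (\<Sum>i\<le>l. w (a + i))"
    by (simp add: sum.distrib lessThan_Suc_atMost[symmetric])
  finally have 2: "(\<Sum>i<Suc l. real (Suc l - i) * w (a + i)) =
     (\<Sum>i<l. real (l - i) * w (a + i)) + (\<Sum>i\<le>l. w (a + i))" .
  show ?case using Suc.IH 1 unfolding 2 by (simp add: growth.simps(2) algebra_simps)
qed simp

text \<open>
  For \<open>w = 1 / h\<close> a block of length \<open>l\<close> and mass much smaller than
  \<open>l\<^sup>3\<close> multiplies the solution by a large factor: the harmonic mean of \<open>h\<close> is
  at most its arithmetic mean, which is much smaller than \<open>l\<^sup>2\<close>. The comparison of means
  is used in the form of the tangent bound \<open>1 / h \<ge> 2 / c - h / c\<^sup>2\<close>.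
\<close>

lemma growth_light_block:
  fixes h :: "nat \<Rightarrow> nat"
  assumes nonneg: "\<And>i. 0 \<le> w i" and l: "0 < l"
    and h: "\<And>i. i < l \<Longrightarrow> 1 \<le> h (a + i) \<and> w (a + i) = 1 / h (a + i)"
    and light: "64 * (\<Sum>i<l. h (a + i)) \<le> l ^ 3"
  shows "16 * growth w a \<le> growth w (a + l)"
proof -
  \<comment> \<open>twice the largest mean \<open>l\<^sup>2 / 64\<close> of \<open>h\<close> that the hypothesis admits\<close>
  define c where "c = real l ^ 2 / 32"
  have c: "0 < c" using l by (simp add: c_def)
  have tangent: "2 / c - h (a + i) / c ^ 2 \<le> w (a + i)" if "i < l" for i
  proof -
    let ?x = "real (h (a + i))"
    have x: "1 \<le> ?x" "w (a + i) = 1 / ?x" using h[OF that] by auto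
    have "0 \<le> (?x - c) ^ 2 / (?x * c ^ 2)" using x by simp
    also have "\<dots> = 1 / ?x - (2 / c - ?x / c ^ 2)"
      using x c by (simp add: field_simps power2_eq_square)
    finally show ?thesis using x by simp
  qed
  have lin: "(\<Sum>i<l. real (l - i)) = real l * (real l + 1) / 2"
  proof -
    have "(\<Sum>i<l. real (l - i)) = (\<Sum>i<l. real (Suc i))"
      by (rule sum.reindex_bij_witness[where i = "\<lambda>i. l - Suc i" and j = "\<lambda>i. l - Suc i"]) auto
    also have "\<dots> = real l * (real l + 1) / 2" by (induction l) (auto simp: field_simps)
    finally show ?thesis .
  qed
  have "(\<Sum>i<l. real (l - i) * h (a + i)) \<le> (\<Sum>i<l. real l * h (a + i))"
    by (intro sum_mono mult_right_mono) auto
  also have "\<dots> = real l * real (\<Sum>i<l. h (a + i))" by (simp add: sum_distrib_left)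
  also have "\<dots> \<le> real l * (real l ^ 3 / 64)"
  proof (rule mult_left_mono)
    have "real (64 * (\<Sum>i<l. h (a + i))) \<le> real (l ^ 3)" using light by (simp only: of_nat_le_iff)
    then show "real (\<Sum>i<l. h (a + i)) \<le> real l ^ 3 / 64" by simp
  qed simp
  finally have quad: "(\<Sum>i<l. real (l - i) * h (a + i)) \<le> real l ^ 4 / 64"
    by (simp add: power_numeral_reduce)
  have "16 \<le> (2 / c) * (real l * (real l + 1) / 2) - (real l ^ 4 / 64) / c ^ 2"
    using l by (simp add: c_def field_simps power_numeral_reduce)
  also have "\<dots> \<le> (2 / c) * (\<Sum>i<l. real (l - i)) - (\<Sum>i<l. real (l - i) * h (a + i)) / c ^ 2"
    unfolding lin using quad by (intro diff_left_mono divide_right_mono) auto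
  also have "\<dots> = (\<Sum>i<l. real (l - i) * (2 / c - h (a + i) / c ^ 2))"
    unfolding sum_distrib_left sum_divide_distrib sum_subtractf[symmetric]
    by (rule sum.cong) (simp_all add: algebra_simps)
  also have "\<dots> \<le> (\<Sum>i<l. real (l - i) * w (a + i))"
    using tangent by (intro sum_mono mult_left_mono) auto
  finally have "16 \<le> 1 + (\<Sum>i<l. real (l - i) * w (a + i))" by simp
  then have "growth w a * 16 \<le> growth w a * (1 + (\<Sum>i<l. real (l - i) * w (a + i)))"
    using growth_ge_1[where w = w, OF nonneg, of a] by (intro mult_left_mono) auto
  also have "\<dots> \<le> growth w (a + l)" by (rule growth_block) (rule nonneg)
  finally show ?thesis by simp
qed

section \<open>The gain for a given profile of column counts\<close>

locale column_counts =
  fixes h :: "nat \<Rightarrow> nat" and R q :: nat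
  assumes q: "1 \<le> q" "4 * q \<le> R"
    and h_pos: "i \<le> R \<Longrightarrow> 1 \<le> h i"
    and light: "64000 * (\<Sum>i\<le>R. h i) \<le> q ^ 3"
begin

lemma sum_split:
  fixes f :: "nat \<Rightarrow> real"
  assumes "x + l \<le> R"
  shows "(\<Sum>y\<in>{x..R}. f y) = (\<Sum>i<l. f (x + i)) + (\<Sum>y\<in>{x + l..R}. f y)"
proof -
  have "{x..R} = {x..<x + l} \<union> {x + l..R}" using assms by auto
  then have "(\<Sum>y\<in>{x..R}. f y) = sum f ({x..<x + l} \<union> {x + l..R})" by (simp only:)
  also have "\<dots> = (\<Sum>y\<in>{x..<x + l}. f y) + (\<Sum>y\<in>{x + l..R}. f y)"
    by (rule sum.union_disjoint) auto
  also have "(\<Sum>y\<in>{x..<x + l}. f y) = (\<Sum>i<l. f (x + i))"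
    using sum.shift_bounds_nat_ivl[of f 0 x l] by (simp add: atLeast0LessThan add.commute)
  finally show ?thesis .
qed

text \<open>
  The shortest admissible block is nearly critical: its mass is comparable to \<open>l\<^sup>3\<close>. The
  length \<open>q\<close> is admissible because the total mass is so small. A single column is not, because
  it is occupied; hence \<open>l \<le> 2 (l - 1)\<close>, which bounds the loss from minimality.
\<close>

lemma block_exists:
  assumes "x \<le> 3 * q"
  obtains l where "0 < l" "l \<le> q" "64 * (\<Sum>i<l. h (x + i)) \<le> l ^ 3" "l ^ 3 \<le> 512 * (\<Sum>i<l. h (x + i))"
proof -
  define P where "P l \<longleftrightarrow> 0 < l \<and> 64 * (\<Sum>i<l. h (x + i)) \<le> l ^ 3" for l
  have "(\<Sum>i<q. h (x + i)) = (\<Sum>y\<in>(\<lambda>i. x + i) ` {..<q}. h y)" by (simp add: sum.reindex)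
  also have "\<dots> \<le> (\<Sum>y\<le>R. h y)" using assms q by (intro sum_mono2) auto
  finally have "P q" using light q by (simp add: P_def)
  define l where "l = (LEAST l. P l)"
  have l: "P l" "l \<le> q" using \<open>P q\<close> unfolding l_def by (rule LeastI, rule Least_le)
  have "l \<noteq> 1" using l(1) h_pos[of x] assms q by (auto simp: P_def)
  then have l2: "2 \<le> l" using l(1) by (auto simp: P_def)
  then obtain m where m: "l = Suc m" "1 \<le> m" by (cases l) auto
  have "\<not> P m" using not_less_Least[of m P, folded l_def] m by simp
  then have "m ^ 3 < 64 * (\<Sum>i<m. h (x + i))" using m by (simp add: P_def)
  then have "m ^ 3 \<le> 64 * (\<Sum>i<l. h (x + i))" by (simp add: m)
  moreover have "l ^ 3 \<le> (2 * m) ^ 3" using m by (intro power_mono) auto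
  ultimately have "l ^ 3 \<le> 512 * (\<Sum>i<l. h (x + i))" by (simp add: power_mult_distrib)
  with l that show ?thesis by (auto simp: P_def)
qed

text \<open>
  Tangent bound for \<open>l \<mapsto> j l\<^sup>3\<close> at \<open>l = A / sqrt j\<close>, with
  \<open>1 / sqrt j\<close> replaced by a telescoping difference. Summed over consecutive blocks of lengths
  \<open>l\<close> with indices \<open>j\<close>, it acts as Hoelder's inequality.
\<close>

lemma weighted_cube_ge:
  assumes j: "1 \<le> j" and l: "0 \<le> l" and A: "0 \<le> A"
  shows "3 * A\<^sup>2 * l - 4 * A ^ 3 * (sqrt j - sqrt (j - 1)) \<le> j * l ^ 3"
proof -
  define s where "s = sqrt j"
  have s: "1 \<le> s" "s ^ 2 = j" using j by (auto simp: s_def)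
  have "sqrt (j - 1) \<le> s" "0 \<le> sqrt (j - 1)" using j by (auto simp: s_def)
  moreover have "1 = (s - sqrt (j - 1)) * (s + sqrt (j - 1))"
    using j s by (simp add: algebra_simps power2_eq_square[symmetric])
  ultimately have "1 \<le> (s - sqrt (j - 1)) * (2 * s)"
    by (smt (verit) mult_left_mono)
  then have "2 * A ^ 3 * 1 \<le> 2 * A ^ 3 * ((s - sqrt (j - 1)) * (2 * s))"
    using A by (intro mult_left_mono) auto
  then have 1: "2 * A ^ 3 \<le> 4 * A ^ 3 * (s - sqrt (j - 1)) * s" by (simp add: algebra_simps)
  have "0 \<le> (l * s - A)\<^sup>2 * (l * s + 2 * A)" using l s A by simp
  also have "\<dots> = s * (j * l ^ 3) - 3 * A\<^sup>2 * l * s + 2 * A ^ 3"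
    unfolding s(2)[symmetric] by (simp add: algebra_simps power2_eq_square power3_eq_cube)
  finally have "(3 * A\<^sup>2 * l - 4 * A ^ 3 * (s - sqrt (j - 1))) * s \<le> (j * l ^ 3) * s"
    using 1 by (simp add: algebra_simps)
  then show ?thesis using s(1) by (simp add: s_def)
qed

text \<open>
  The interval from \<open>x\<close> on is cut into nearly critical blocks. The \<open>j\<close>-th of them has
  mass of order \<open>l\<^sup>3\<close>, and there the logarithm of the solution is at least \<open>j\<close>, since
  each block multiplies the solution by \<open>16\<close>. So the sum is at least of the order of the sum of
  \<open>j l\<^sup>3\<close> over the blocks. The induction peels off one block and keeps the sum of the tangent
  bounds; \<open>C\<close> bounds the indices of the blocks that start at or before \<open>3 q\<close>.
\<close>

lemma tail_weight_ge:
  fixes A C :: real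
  assumes nonneg: "\<And>i. 0 \<le> w i" and A: "0 \<le> A"
    and w: "\<And>i. a \<le> i \<Longrightarrow> i \<le> R \<Longrightarrow> w i = 1 / h i"
  shows "a \<le> x \<Longrightarrow> 1 \<le> j \<Longrightarrow> 16 ^ j \<le> growth w x \<Longrightarrow> real j \<le> C + 1 \<Longrightarrow>
      (x \<le> 3 * q \<Longrightarrow> real j + 3 * real q \<le> C + real x) \<Longrightarrow>
    (3 * A\<^sup>2 * (3 * real q - real x) - 4 * A ^ 3 * (sqrt C - sqrt (real j - 1))) / 512
      \<le> (\<Sum>y\<in>{x..R}. h y * log 16 (growth w y))"
proof (induction "R - x" arbitrary: x j rule: less_induct)
  case less
  have growth1: "1 \<le> growth w y" for y by (rule growth_ge_1) (rule nonneg)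
  show ?case
  proof (cases "x \<le> 3 * q")
    case False
    then have "3 * A\<^sup>2 * (3 * real q - real x) \<le> 0"
      using A by (intro mult_nonneg_nonpos) auto
    moreover have "0 \<le> 4 * A ^ 3 * (sqrt C - sqrt (real j - 1))"
      using less.prems(4) A by (intro mult_nonneg_nonneg) auto
    ultimately have "(3 * A\<^sup>2 * (3 * real q - real x) - 4 * A ^ 3 * (sqrt C - sqrt (real j - 1))) / 512 \<le> 0"
      by (intro divide_nonpos_pos) auto
    moreover have "0 \<le> log 16 (growth w y)" for y using growth1[of y] by simp
    then have "0 \<le> (\<Sum>y\<in>{x..R}. h y * log 16 (growth w y))"
      by (intro sum_nonneg mult_nonneg_nonneg) auto
    ultimately show ?thesis by (rule order_trans)
  next
    case True
    then obtain l where l: "0 < l" "l \<le> q" "64 * (\<Sum>i<l. h (x + i)) \<le> l ^ 3"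
      "l ^ 3 \<le> 512 * (\<Sum>i<l. h (x + i))" by (rule block_exists)
    have xl: "x + l \<le> R" using True l q by simp
    have "16 * growth w x \<le> growth w (x + l)"
      using l xl less.prems(1) w h_pos by (intro growth_light_block[where h = h] nonneg) auto
    with less.prems(3) have "16 ^ Suc j \<le> growth w (x + l)" by simp
    moreover have "real j + 3 * real q \<le> C + real x" using less.prems True by simp
    moreover have "real x \<le> 3 * real q" using True by simp
    ultimately have IH: "(3 * A\<^sup>2 * (3 * real q - real (x + l)) - 4 * A ^ 3 * (sqrt C - sqrt (real (Suc j) - 1))) / 512
      \<le> (\<Sum>y\<in>{x + l..R}. h y * log 16 (growth w y))"
      using l xl less.prems(1,2) by (intro less.hyps) auto
    have "j \<le> log 16 (growth w (x + i))" for i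
    proof -
      have "16 ^ j \<le> growth w (x + i)"
        using less.prems(3) growth_mono[where w = w and m = x and n = "x + i", OF nonneg] by simp
      then show ?thesis using growth1[of "x + i"] by (simp add: le_log_iff powr_realpow)
    qed
    then have "(\<Sum>i<l. h (x + i) * real j) \<le> (\<Sum>i<l. h (x + i) * log 16 (growth w (x + i)))"
      by (intro sum_mono mult_left_mono) auto
    moreover have "real j * real l ^ 3 / 512 \<le> (\<Sum>i<l. h (x + i) * real j)"
    proof -
      have "real (l ^ 3) \<le> real (512 * (\<Sum>i<l. h (x + i)))" using l(4) by (simp only: of_nat_le_iff)
      then have "real j * real l ^ 3 \<le> real j * (512 * (\<Sum>i<l. real (h (x + i))))"
        by (intro mult_left_mono) auto
      moreover have "(\<Sum>i<l. h (x + i) * real j) = real j * (\<Sum>i<l. real (h (x + i)))"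
        by (simp add: sum_distrib_left mult.commute)
      ultimately show ?thesis by simp
    qed
    moreover have "(\<Sum>y\<in>{x..R}. h y * log 16 (growth w y)) =
        (\<Sum>i<l. h (x + i) * log 16 (growth w (x + i))) + (\<Sum>y\<in>{x + l..R}. h y * log 16 (growth w y))"
      by (rule sum_split[OF xl])
    moreover have "3 * A\<^sup>2 * real l - 4 * A ^ 3 * (sqrt (real j) - sqrt (real j - 1)) \<le> real j * real l ^ 3"
      using less.prems(2) A by (intro weighted_cube_ge) auto
    ultimately show ?thesis using IH by (simp add: algebra_simps add_divide_distrib diff_divide_distrib)
  qed
qed

text \<open>
  Columns beyond \<open>R\<close> are left without constraint on their count, so the barrier must not bend
  there; before \<open>a\<close> it stays equal to \<open>1\<close>.
\<close>

definition barrier_rate :: "nat \<Rightarrow> nat \<Rightarrow> real" where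
  "barrier_rate a i = (if a \<le> i \<and> i \<le> R then 1 / h i else 0)"

text \<open>
  The halved terminal weight costs a factor \<open>2\<close> for each site of the first block, where the
  barrier has not grown yet. For the columns behind this block to outweigh the cost, their mass has to
  be at least that of the block. If this failed at every starting point, the remaining mass \<open>Z\<close>
  would decay geometrically along the blocks, whose lengths are of order \<open>Z\<^sup>1\<^sup>/\<^sup>3\<close>, and
  would vanish within distance \<open>q\<close>, although all columns up to \<open>R\<close> are occupied. The minimiser of \<open>\<Psi>\<close> below is a good
  starting point at once.
\<close>

lemma barrier_start:
  obtains a l where "a \<le> q" "0 < l" "l \<le> q" "64 * (\<Sum>i<l. h (a + i)) \<le> l ^ 3"
    "(\<Sum>i<l. h (a + i)) \<le> (\<Sum>y\<in>{a + l..R}. h y)"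
proof -
  define Z where "Z x = (\<Sum>y\<in>{x..R}. h y)" for x
  define r where "r x = root 3 (real (Z x))" for x
  define \<Psi> where "\<Psi> x = real x + 40 * r x" for x
  have r: "0 \<le> r x" "r x ^ 3 = Z x" for x by (auto simp: r_def)
  obtain a where a: "a \<in> {..R}" "\<And>x. x \<in> {..R} \<Longrightarrow> \<Psi> a \<le> \<Psi> x"
  proof -
    have "\<Psi> (arg_min_on \<Psi> {..R}) \<le> \<Psi> x" if "x \<in> {..R}" for x
      using arg_min_least[of "{..R}" x \<Psi>] that by auto
    moreover have "arg_min_on \<Psi> {..R} \<in> {..R}" by (rule arg_min_if_finite) auto
    ultimately show ?thesis using that by blast
  qed
  have "Z 0 = (\<Sum>i\<le>R. h i)" by (simp add: Z_def atLeast0AtMost)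
  with light have "real (64000 * Z 0) \<le> real (q ^ 3)" by (simp only: of_nat_le_iff)
  then have "(40 * r 0) ^ 3 \<le> real q ^ 3" by (simp add: power_mult_distrib r)
  then have "40 * r 0 \<le> q" by (subst (asm) power_mono_iff) (auto simp: r)
  with a(2)[of 0] r(1)[of a] have aq: "a \<le> q" by (simp add: \<Psi>_def)
  then have "a \<le> 3 * q" by simp
  then obtain l where l: "0 < l" "l \<le> q" "64 * (\<Sum>i<l. h (a + i)) \<le> l ^ 3"
    "l ^ 3 \<le> 512 * (\<Sum>i<l. h (a + i))" by (rule block_exists)
  have al: "a + l \<le> R" using aq l q by simp
  have "real (Z a) = (\<Sum>i<l. real (h (a + i))) + real (Z (a + l))"
    using sum_split[OF al, of "\<lambda>y. real (h y)"] by (simp add: Z_def)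
  then have split: "real (Z a) = real (\<Sum>i<l. h (a + i)) + real (Z (a + l))" by simp
  have "real (l ^ 3) \<le> real (512 * (\<Sum>i<l. h (a + i)))" using l(4) by (simp only: of_nat_le_iff)
  also have "\<dots> \<le> 512 * real (Z a)" using split by simp
  finally have "real l ^ 3 \<le> (8 * r a) ^ 3" by (simp add: power_mult_distrib r)
  then have "real l \<le> 8 * r a" by (subst (asm) power_mono_iff) (auto simp: r)
  moreover have "\<Psi> a \<le> \<Psi> (a + l)" using a(2) al by simp
  ultimately have "4 / 5 * r a \<le> r (a + l)" by (simp add: \<Psi>_def)
  then have "(4 / 5 * r a) ^ 3 \<le> r (a + l) ^ 3" using r by (intro power_mono) auto
  then have "(4 / 5) ^ 3 * real (Z a) \<le> real (Z (a + l))" by (simp only: power_mult_distrib r)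
  then have "64 * real (Z a) \<le> 125 * real (Z (a + l))" by (simp add: power3_eq_cube)
  with split have "real (\<Sum>i<l. h (a + i)) \<le> real (Z (a + l))" by linarith
  then have "(\<Sum>i<l. h (a + i)) \<le> Z (a + l)" by (simp only: of_nat_le_iff)
  with aq l that show ?thesis by (auto simp: Z_def)
qed

text \<open>
  The solution is at least \<open>16\<close> behind the first block, so there half of the logarithm covers
  the loss of one per site, for those sites as well as for the sites of the first block.
\<close>

lemma barrier_gain:
  obtains a where "a \<le> q"
    "real q ^ 2 / 4096 \<le> (\<Sum>y\<in>{a..R}. h y * (log 2 (growth (barrier_rate a) y) - 1))"
proof -
  obtain a l where a: "a \<le> q" and l: "0 < l" "l \<le> q" "64 * (\<Sum>i<l. h (a + i)) \<le> l ^ 3"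
    and half: "(\<Sum>i<l. h (a + i)) \<le> (\<Sum>y\<in>{a + l..R}. h y)" by (rule barrier_start)
  define G where "G = growth (barrier_rate a)"
  define b where "b = a + l"
  have b: "b \<le> 2 * q" "b \<le> R" "a \<le> b" using a l q by (auto simp: b_def)
  have nonneg: "0 \<le> barrier_rate a i" for i by (simp add: barrier_rate_def)
  have G1: "1 \<le> G y" for y unfolding G_def by (rule growth_ge_1) (rule nonneg)
  have "16 * G a \<le> G b" unfolding G_def b_def
    using l b h_pos by (intro growth_light_block[where h = h] nonneg) (auto simp: barrier_rate_def b_def)
  then have Gb: "16 \<le> G b" using G1[of a] by simp
  define S where "S = (\<Sum>y\<in>{b..R}. h y * log 16 (G y))"
  have gain: "real q ^ 2 / 8192 \<le> S"
  proof -
    define s where "s = sqrt q"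
    have s: "s ^ 2 = q" "0 \<le> s" "sqrt (4 * real q) = 2 * s" by (auto simp: s_def real_sqrt_mult)
    define P where "P = 3 * (s / 4)\<^sup>2 * (3 * real q - real b)"
    define Q where "Q = (s / 4) ^ 3 * (2 * s)"
    \<comment> \<open>the parameters \<open>A = sqrt q / 4\<close> and \<open>C = 4 q\<close> balance the two terms of the bound\<close>
    have "(3 * (s / 4)\<^sup>2 * (3 * real q - real b) - 4 * (s / 4) ^ 3 * (sqrt (4 * real q) - sqrt (real 1 - 1))) / 512 \<le> S"
      unfolding S_def G_def using Gb b q l
      by (intro tail_weight_ge[where a = a] nonneg) (auto simp: barrier_rate_def s b_def G_def)
    then have "(P - 4 * Q) / 512 \<le> S" unfolding s(3) P_def Q_def by (simp add: mult.assoc)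
    moreover have "3 * (s / 4)\<^sup>2 * real q \<le> P"
      unfolding P_def using b by (intro mult_left_mono) auto
    moreover have sq: "3 * (s / 4)\<^sup>2 * real q = 3 / 16 * real q ^ 2" "Q = real q ^ 2 / 32"
      unfolding s(1)[symmetric] Q_def by (simp_all add: power_numeral_reduce field_simps)
    ultimately show ?thesis unfolding sq by simp
  qed
  have "4 * S = (\<Sum>y\<in>{b..R}. h y * log 2 (G y))"
  proof -
    have "4 * log 16 z = log 2 z" for z :: real
    proof -
      have "log 2 16 = (4 :: real)" using log_of_power_eq[of 16 2 4] by simp
      then show ?thesis using log_base_change[of 2 16 z] by simp
    qed
    then show ?thesis by (simp add: S_def sum_distrib_left mult.left_commute)
  qed
  moreover have "(\<Sum>y\<in>{b..R}. 4 * real (h y)) \<le> (\<Sum>y\<in>{b..R}. h y * log 2 (G y))"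
  proof (rule sum_mono)
    fix y assume "y \<in> {b..R}"
    then have "16 \<le> G y" using Gb growth_mono[where w = "barrier_rate a" and m = b and n = y, OF nonneg] by (simp add: G_def)
    then have "4 \<le> log 2 (G y)" by (simp add: le_log_iff)
    then show "4 * real (h y) \<le> h y * log 2 (G y)"
      using mult_left_mono[of 4 "log 2 (G y)" "real (h y)"] by (simp add: mult.commute)
  qed
  moreover have "- (\<Sum>y\<in>{b..R}. real (h y)) \<le> (\<Sum>i<l. h (a + i) * (log 2 (G (a + i)) - 1))"
  proof -
    have "(\<Sum>i<l. - real (h (a + i))) \<le> (\<Sum>i<l. h (a + i) * (log 2 (G (a + i)) - 1))"
    proof (rule sum_mono)
      fix i
      have "0 \<le> log 2 (G (a + i))" using G1[of "a + i"] by simp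
      then have "real (h (a + i)) * (- 1) \<le> h (a + i) * (log 2 (G (a + i)) - 1)"
        by (intro mult_left_mono) auto
      then show "- real (h (a + i)) \<le> h (a + i) * (log 2 (G (a + i)) - 1)" by simp
    qed
    moreover have "real (\<Sum>i<l. h (a + i)) \<le> real (\<Sum>y\<in>{b..R}. h y)"
      using half by (simp only: of_nat_le_iff b_def)
    ultimately show ?thesis by (simp add: sum_negf)
  qed
  moreover have "(\<Sum>y\<in>{a..R}. h y * (log 2 (G y) - 1)) =
      (\<Sum>i<l. h (a + i) * (log 2 (G (a + i)) - 1)) + (\<Sum>y\<in>{b..R}. h y * (log 2 (G y) - 1))"
    unfolding b_def by (rule sum_split) (use b b_def in auto)
  moreover have "(\<Sum>y\<in>{b..R}. h y * (log 2 (G y) - 1)) =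
      (\<Sum>y\<in>{b..R}. h y * log 2 (G y)) - (\<Sum>y\<in>{b..R}. real (h y))"
    by (simp add: sum_subtractf right_diff_distrib)
  ultimately have "2 * S \<le> (\<Sum>y\<in>{a..R}. h y * (log 2 (G y) - 1))"
    by (simp add: sum_distrib_left[symmetric])
  with gain have "real q ^ 2 / 4096 \<le> (\<Sum>y\<in>{a..R}. h y * (log 2 (G y) - 1))" by simp
  with a that show ?thesis by (simp add: G_def)
qed

end

section \<open>Probability of reaching the tip\<close>

context column_counts
begin

text \<open>
  On \<open>J\<close> the weights are \<open>e = F / 2\<close>, and with \<open>F'' = F / h\<close> the barrier condition
  holds with equality. The supermartingale starts from one, while a cluster with the profile
  \<open>h\<close> has weight at least \<open>W\<close>, the product of \<open>(F / 2)\<^sup>h\<close> over \<open>J\<close>; the sites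
  outside \<open>J\<close> contribute factors at least one. Markov's inequality concludes.
\<close>

lemma profile_probability_le:
  "measure (measure_spmf (idla k)) {A. \<forall>x\<le>R. card (column A (int x)) = h x} \<le> 2 powr (- (real q ^ 2 / 4096))"
proof -
  obtain a where a: "a \<le> q"
    and gain: "real q ^ 2 / 4096 \<le> (\<Sum>y\<in>{a..R}. h y * (log 2 (growth (barrier_rate a) y) - 1))"
    by (rule barrier_gain)
  define G where "G = growth (barrier_rate a)"
  define J where "J = int ` {a..R}"
  define F where "F x = G (nat x)" for x
  define e where "e x = (if x \<in> J then F x / 2 else F x)" for x
  have nonneg: "0 \<le> barrier_rate a i" for i by (simp add: barrier_rate_def)
  have G1: "1 \<le> G y" for y unfolding G_def by (rule growth_ge_1) (rule nonneg)
  have diff: "F (x + 1) + F (x - 1) - 2 * F x = (if x < 0 then 0 else barrier_rate a (nat x) * F x)" for x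
  proof -
    consider "x < 0" | "x = 0" | n where "x = int (Suc n)"
    proof (cases "0 < x")
      case True
      then have "x = int (Suc (nat x - 1))" by simp
      then show ?thesis by (rule that(3))
    qed (use that(1,2) in linarith)
    then show ?thesis
    proof cases
      case (3 n)
      have "nat (x + 1) = Suc (Suc n)" "nat (x - 1) = n" "nat x = Suc n" using 3 by auto
      then show ?thesis using growth_second_difference[of "barrier_rate a" n] 3 by (simp add: F_def G_def)
    qed (auto simp: F_def G_def growth.simps(2)[of _ 0, simplified])
  qed
  interpret axis_barrier F e J "\<lambda>x. h (nat x)"
  proof
    fix x
    show "0 \<le> e x" "e x \<le> F x" using G1[of "nat x"] by (auto simp: e_def F_def)
    show "F (x + 1) + F (x - 1) \<le> 2 * F x" if "x \<notin> J"
    proof -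
      have "barrier_rate a (nat x) = 0 \<or> x < 0"
        using that unfolding J_def barrier_rate_def
        by (metis atLeastAtMost_iff imageI int_nat_eq not_less)
      then have "F (x + 1) + F (x - 1) - 2 * F x = 0" using diff[of x] by auto
      then show ?thesis by linarith
    qed
    show "h (nat x) * (F (x + 1) + F (x - 1) - 2 * F x) \<le> 2 * (F x - e x)" if "x \<in> J"
    proof -
      obtain y where y: "x = int y" "a \<le> y" "y \<le> R" using \<open>x \<in> J\<close> by (auto simp: J_def)
      then have "h y * barrier_rate a y = 1" using h_pos[of y] by (auto simp: barrier_rate_def)
      then have "h y * (barrier_rate a y * F x) = F x" by (metis mult.assoc mult_1)
      moreover have "F (x + 1) + F (x - 1) - 2 * F x = barrier_rate a y * F x"
        using diff[of x] y(1) by simp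
      moreover have "2 * (F x - e x) = F x" using that by (simp add: e_def)
      moreover have "nat x = y" using y(1) by simp
      ultimately show ?thesis by (simp only: order_refl)
    qed
  qed
  define E where "E = {A. \<forall>x\<le>R. card (column A (int x)) = h x}"
  define W where "W = (\<Prod>y\<in>{a..R}. (G y / 2) ^ h y)"
  have W: "2 powr (real q ^ 2 / 4096) \<le> W"
  proof -
    have "(G y / 2) ^ h y = 2 powr (h y * (log 2 (G y) - 1))" for y
    proof -
      have "G y / 2 = 2 powr (log 2 (G y) - 1)" using G1[of y] by (simp add: powr_diff)
      then have "(G y / 2) ^ h y = (2 powr (log 2 (G y) - 1)) ^ h y" by (simp only:)
      also have "\<dots> = (2 powr (log 2 (G y) - 1)) powr h y" by (rule powr_realpow[symmetric]) simp
      also have "\<dots> = 2 powr (h y * (log 2 (G y) - 1))" by (simp only: powr_powr mult.commute)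
      finally show ?thesis .
    qed
    then have "W = 2 powr (\<Sum>y\<in>{a..R}. h y * (log 2 (G y) - 1))"
      by (simp add: W_def powr_sum)
    then show ?thesis using gain by (simp add: G_def)
  qed
  have weight: "columns_bounded J (\<lambda>x. h (nat x)) A" "W \<le> (\<Prod>z\<in>A. e (fst z))" if "finite A" "A \<in> E" for A
  proof -
    show "columns_bounded J (\<lambda>x. h (nat x)) A" using that(2) by (auto simp: columns_bounded_def E_def J_def)
    define B where "B = {z \<in> A. fst z \<in> J}"
    have finB: "finite B" using that(1) by (simp add: B_def)
    have "(\<Prod>z\<in>B. e (fst z)) = (\<Prod>x\<in>J. \<Prod>z | z \<in> B \<and> fst z = x. e (fst z))"
      by (rule prod.group[symmetric]) (auto simp: B_def that(1) J_def)
    also have "\<dots> = (\<Prod>x\<in>J. e x ^ card (column A x))"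
    proof (rule prod.cong[OF refl])
      fix x assume "x \<in> J"
      then have "{z \<in> B. fst z = x} = Pair x ` column A x" by (auto simp: B_def column_def)
      then have "card {z \<in> B. fst z = x} = card (column A x)" by (simp add: card_image inj_on_def)
      moreover have "(\<Prod>z | z \<in> B \<and> fst z = x. e (fst z)) = (\<Prod>z | z \<in> B \<and> fst z = x. e x)"
        by (rule prod.cong) auto
      ultimately show "(\<Prod>z | z \<in> B \<and> fst z = x. e (fst z)) = e x ^ card (column A x)" by simp
    qed
    also have "\<dots> = (\<Prod>y\<in>{a..R}. (G y / 2) ^ h y)"
      unfolding J_def using that(2)
      by (subst prod.reindex) (auto simp: E_def e_def J_def F_def intro!: prod.cong)
    finally have "(\<Prod>z\<in>B. e (fst z)) = W" by (simp add: W_def)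
    moreover have "(\<Prod>z\<in>A. e (fst z)) = (\<Prod>z\<in>A - B. e (fst z)) * (\<Prod>z\<in>B. e (fst z))"
      by (rule prod.subset_diff) (auto simp: B_def that(1))
    moreover have "1 \<le> (\<Prod>z\<in>A - B. e (fst z))"
      by (rule prod_ge_1) (auto simp: B_def e_def F_def G1)
    moreover have "0 \<le> W" using W powr_ge_zero order_trans by blast
    ultimately show "W \<le> (\<Prod>z\<in>A. e (fst z))" by (simp add: mult_le_cancel_right1 mult_right_mono[of 1, simplified])
  qed
  have W0: "0 < W" using W by (rule less_le_trans[rotated]) simp
  have "ennreal W * emeasure (measure_spmf (idla k)) E = (\<integral>\<^sup>+A. ennreal W * indicator E A \<partial>measure_spmf (idla k))"
    by (simp add: nn_integral_cmult_indicator)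
  also have "\<dots> \<le> (\<integral>\<^sup>+A. (if columns_bounded J (\<lambda>x. h (nat x)) A then ennreal (\<Prod>z\<in>A. e (fst z)) else 0) \<partial>measure_spmf (idla k))"
    using weight finite_idla by (intro nn_integral_mono_AE)
      (auto simp: AE_measure_spmf_iff indicator_def intro!: ennreal_leI)
  also have "\<dots> \<le> ennreal (F 0 ^ k)" by (rule idla_weight_le)
  also have "F 0 ^ k = 1" by (simp add: F_def G_def)
  finally have "ennreal (W * measure (measure_spmf (idla k)) E) \<le> ennreal 1"
    using W0 by (simp add: measure_spmf.emeasure_eq_measure ennreal_mult)
  then have le1: "W * measure (measure_spmf (idla k)) E \<le> 1" by (simp only: ennreal_le_iff zero_le_one)
  have "2 powr (real q ^ 2 / 4096) * measure (measure_spmf (idla k)) E \<le> 1"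
    using mult_right_mono[OF W measure_nonneg[of "measure_spmf (idla k)" E]] le1 by linarith
  then show ?thesis by (simp add: E_def powr_minus field_simps)
qed

end

lemma idla_axis_segment:
  assumes "A \<in> set_spmf (idla k)" "(int R, 0) \<in> A" "x \<le> R"
  shows "(int x, 0) \<in> A"
proof -
  have "(int (R - n), 0) \<in> A" if "n \<le> R" for n
    using that
  proof (induction n)
    case (Suc n)
    then have "(int (R - n) - 1, 0) \<in> A" by (intro idla_axis_connected[OF assms(1)]) auto
    moreover have "int (R - n) - 1 = int (R - Suc n)" using Suc.prems by simp
    ultimately show ?case by (simp only:)
  qed (use assms(2) in simp)
  from this[of "R - x"] assms(3) show ?thesis by simp
qed

lemma sum_card_column_le:
  assumes "finite A"
  shows "(\<Sum>x\<le>R. card (column A (int x))) \<le> card A"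
proof -
  have "(\<Sum>x\<le>R. card (column A (int x))) = card (SIGMA x:{..R}. column A (int x))"
    using assms by (simp add: card_SigmaI finite_column)
  also have "\<dots> = card ((\<lambda>(x, y). (int x, y)) ` (SIGMA x:{..R}. column A (int x)))"
    by (rule card_image[symmetric]) (auto simp: inj_on_def)
  also have "\<dots> \<le> card A" using assms by (intro card_mono) (auto simp: column_def)
  finally show ?thesis .
qed

text \<open>
  Union bound over the column counts of the final cluster. All counts are positive because the axis is
  occupied up to the tip, and at most \<open>N\<close>, so there are at most \<open>N\<^sup>R\<^sup>+\<^sup>1\<close>
  profiles.
\<close>

lemma tip_probability_le:
  assumes q: "1 \<le> q" "4 * q \<le> R" and N: "64000 * N \<le> q ^ 3"
  shows "measure (measure_spmf (idla N)) {A. (int R, 0) \<in> A} \<le> real N ^ Suc R * 2 powr (- (real q ^ 2 / 4096))"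
proof -
  let ?M = "measure_spmf (idla N)"
  define H where "H = {h \<in> {..R} \<rightarrow>\<^sub>E {1..N}. (\<Sum>i\<le>R. h i) \<le> N}"
  define E where "E h = {A. \<forall>x\<le>R. card (column A (int x)) = h x}" for h
  have finP: "finite ({..R} \<rightarrow>\<^sub>E {1..N})" by (simp add: finite_PiE)
  then have finH: "finite H" by (simp add: H_def)
  have "measure ?M {A. (int R, 0) \<in> A} \<le> measure ?M (\<Union>h\<in>H. E h)"
  proof (rule measure_spmf.finite_measure_mono_AE)
    show "AE A in ?M. A \<in> {A. (int R, 0) \<in> A} \<longrightarrow> A \<in> (\<Union>h\<in>H. E h)"
      unfolding AE_measure_spmf_iff
    proof (intro ballI impI)
      fix A assume A: "A \<in> set_spmf (idla N)" "A \<in> {A. (int R, 0) \<in> A}"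
      have fin: "finite A" using A(1) by (rule finite_idla)
      define h where "h = (\<lambda>x\<in>{..R}. card (column A (int x)))"
      have sum: "(\<Sum>x\<le>R. card (column A (int x))) \<le> N"
        using sum_card_column_le[OF fin, of R] card_idla[OF A(1)] by linarith
      have "1 \<le> card (column A (int x)) \<and> card (column A (int x)) \<le> N" if "x \<le> R" for x
      proof
        have "0 \<in> column A (int x)"
          using idla_axis_segment[OF A(1) _ that] A(2) by (simp add: column_def)
        then show "1 \<le> card (column A (int x))"
          using finite_column[OF fin] by (simp add: Suc_le_eq card_gt_0_iff) blast
        have "card (column A (int x)) \<le> (\<Sum>x\<le>R. card (column A (int x)))"
          using that by (intro member_le_sum) auto
        with sum show "card (column A (int x)) \<le> N" by linarith
      qed
      then have "h \<in> H" using sum by (auto simp: H_def h_def)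
      moreover have "A \<in> E h" by (simp add: E_def h_def)
      ultimately show "A \<in> (\<Union>h\<in>H. E h)" by blast
    qed
  qed simp
  also have "\<dots> \<le> (\<Sum>h\<in>H. measure ?M (E h))"
    by (rule measure_spmf.finite_measure_subadditive_finite) (auto simp: finH)
  also have "\<dots> \<le> (\<Sum>h\<in>H. 2 powr (- (real q ^ 2 / 4096)))"
  proof (rule sum_mono)
    fix h assume h: "h \<in> H"
    have "64000 * (\<Sum>i\<le>R. h i) \<le> q ^ 3" using h N by (auto simp: H_def)
    then interpret column_counts h R q using h q by unfold_locales (auto simp: H_def PiE_iff)
    show "measure ?M (E h) \<le> 2 powr (- (real q ^ 2 / 4096))"
      unfolding E_def by (rule profile_probability_le)
  qed
  also have "\<dots> = card H * 2 powr (- (real q ^ 2 / 4096))" by simp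
  also have "\<dots> \<le> real N ^ Suc R * 2 powr (- (real q ^ 2 / 4096))"
  proof (rule mult_right_mono)
    have "card H \<le> card ({..R} \<rightarrow>\<^sub>E {1..N})" using finP by (intro card_mono) (auto simp: H_def)
    also have "\<dots> = N ^ Suc R" by (simp add: card_PiE)
    finally show "real (card H) \<le> real N ^ Suc R" by (metis of_nat_le_iff of_nat_power)
  qed simp
  finally show ?thesis .
qed

text \<open>
  As \<open>N\<close> is at most \<open>R\<^sup>3\<close>, the number of profiles is \<open>exp (O(R ln R))\<close> and is
  absorbed by half of the exponent once \<open>R\<close> exceeds \<open>R\<^sub>0\<close>. For smaller \<open>R\<close>
  the choice of \<open>\<beta>\<close> leaves no explorer at all.
\<close>

theorem corollary1p7:
  shows "\<exists>(\<beta>::real) (\<kappa>\<^sub>2::real). \<beta> > 0 \<and> \<kappa>\<^sub>2 > 0 \<and>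
    (\<forall>(R::int) (n::int). real (d_comb n) < \<beta> * real_of_int R ^ 3 \<longrightarrow>
       measure (measure_spmf (idla_cluster n)) {A. (R, 0) \<in> A}
         \<le> exp (- \<kappa>\<^sub>2 * real_of_int R ^ 2))"
proof -
  define \<kappa> :: real where "\<kappa> = ln 2 / 524288"
  have "\<kappa> > 0" by (simp add: \<kappa>_def)
  have "\<forall>\<^sub>F x in at_top. ln x / x < \<kappa> / 6"
    by (rule order_tendstoD(2)[OF ln_x_over_x_tendsto_0]) (simp add: \<kappa>_def)
  then obtain b where b: "\<And>x. b \<le> x \<Longrightarrow> ln x / x < \<kappa> / 6" by (auto simp: eventually_at_top_linorder)
  define R\<^sub>0 where "R\<^sub>0 = max 4 b"
  define \<beta> where "\<beta> = min (1 / 32768000) (1 / R\<^sub>0 ^ 3)"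
  have R0: "4 \<le> R\<^sub>0" "b \<le> R\<^sub>0" by (auto simp: R\<^sub>0_def)
  have "\<beta> > 0" using R0 by (simp add: \<beta>_def)
  moreover have "measure (measure_spmf (idla_cluster n)) {A. (R, 0) \<in> A} \<le> exp (- \<kappa> * real_of_int R ^ 2)"
    if less: "real (d_comb n) < \<beta> * real_of_int R ^ 3" for R n
  proof (cases "d_comb n = 0")
    case True
    then have "measure (measure_spmf (idla_cluster n)) {A. (R, 0) \<in> A} = 0"
      by (simp add: idla_cluster_def measure_spmf_zero_iff)
    then show ?thesis by simp
  next
    case False
    define N where "N = d_comb n"
    have N: "1 \<le> real N" "real N < \<beta> * real_of_int R ^ 3" using False less by (auto simp: N_def)
    have "0 < \<beta> * real_of_int R ^ 3" using N by linarith
    then have R_pos: "0 < R" using \<open>\<beta> > 0\<close> by (simp add: zero_less_mult_iff zero_less_power_eq)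
    define m where "m = nat R"
    have m: "R = int m" "0 < m" using R_pos by (auto simp: m_def)
    define q where "q = m div 4"
    have le: "\<beta> * real m ^ 3 \<le> 1 / R\<^sub>0 ^ 3 * real m ^ 3" "\<beta> * real m ^ 3 \<le> 1 / 32768000 * real m ^ 3"
      by (rule mult_right_mono; simp add: \<beta>_def)+
    have N': "real N < \<beta> * real m ^ 3" using N(2) m by simp
    have small: "real N < 1 / 32768000 * real m ^ 3" using N' le(2) by (rule less_le_trans)
    have "real N < 1 / R\<^sub>0 ^ 3 * real m ^ 3" using N' le(1) by (rule less_le_trans)
    then have "real N * R\<^sub>0 ^ 3 < real m ^ 3" using R0(1) by (simp add: field_simps)
    moreover have "1 * R\<^sub>0 ^ 3 \<le> real N * R\<^sub>0 ^ 3" using N(1) R0(1) by (intro mult_right_mono) auto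
    ultimately have "R\<^sub>0 ^ 3 < real m ^ 3" by simp
    then have mR: "R\<^sub>0 < real m" by (rule power_less_imp_less_base) simp
    have q: "1 \<le> q" "4 * q \<le> m" "m \<le> 8 * q"
    proof -
      have "4 \<le> m" using mR R0 by linarith
      then show "1 \<le> q" "4 * q \<le> m" "m \<le> 8 * q" unfolding q_def by presburger+
    qed
    have "real m ^ 3 \<le> (8 * real q) ^ 3" using q(3) by (intro power_mono) auto
    with small have "real (64000 * N) \<le> real (q ^ 3)" by (simp add: power_mult_distrib)
    then have "64000 * N \<le> q ^ 3" by (simp only: of_nat_le_iff)
    from tip_probability_le[OF q(1,2) this]
    have "measure (measure_spmf (idla_cluster n)) {A. (R, 0) \<in> A} \<le> real N ^ Suc m * 2 powr (- (real q ^ 2 / 4096))"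
      by (simp add: idla_cluster_def N_def m)
    also have "\<dots> = exp (real (Suc m) * ln N - ln 2 * (real q ^ 2 / 4096))"
    proof -
      have "real N ^ Suc m = exp (real (Suc m) * ln N)"
        using N(1) by (simp only: exp_of_nat_mult) simp
      moreover have "2 powr (- (real q ^ 2 / 4096)) = exp (- (ln 2 * (real q ^ 2 / 4096)))"
        by (simp add: powr_def mult.commute)
      ultimately show ?thesis by (simp only: mult_exp_exp add_uminus_conv_diff)
    qed
    also have "\<dots> \<le> exp (- \<kappa> * real_of_int R ^ 2)"
    proof -
      have "real m ^ 2 \<le> (8 * real q) ^ 2" using q(3) by (intro power_mono) auto
      then have 1: "real m ^ 2 / 262144 \<le> real q ^ 2 / 4096" by (simp add: power_mult_distrib)
      have "ln 2 * (real m ^ 2 / 262144) \<le> ln 2 * (real q ^ 2 / 4096)"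
        using 1 by (intro mult_left_mono) auto
      then have 2: "2 * \<kappa> * real m ^ 2 \<le> ln 2 * (real q ^ 2 / 4096)" by (simp add: \<kappa>_def)
      have "real N \<le> real m ^ 3" using small N(1) by linarith
      then have "ln N \<le> ln (real m ^ 3)" using N(1) m(2) by simp
      also have "\<dots> = 3 * ln m" using m by (simp add: ln_realpow)
      finally have "real (Suc m) * ln N \<le> (2 * real m) * (3 * ln m)"
        using m N(1) by (intro mult_mono) auto
      also have "\<dots> = 6 * real m ^ 2 * (ln m / m)" using m by (simp add: power2_eq_square)
      also have "\<dots> \<le> 6 * real m ^ 2 * (\<kappa> / 6)"
        using b[of "real m"] mR R0 by (intro mult_left_mono) auto
      finally have "real (Suc m) * ln N \<le> \<kappa> * real m ^ 2" by (simp add: mult.commute)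
      with 2 show ?thesis by (simp add: m)
    qed
    finally show ?thesis .
  qed
  ultimately show ?thesis using \<open>\<kappa> > 0\<close> by blast
qed

end
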